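(* Let $\mathbf M\in\mathbb R^{d\times d}$ be symmetric positive semidefinite, let $k\in\{1,\dots,d\}$ with $\lambda_k(\mathbf M)>0$, and let $\epsilon\in[0,1]$. If $\mathbf U\in\mathbb R^{d\times k}$ is an $\epsilon$-$k$-ePCA of $\mathbf M$, then for any $\Gamma\in(0,1)$, $\mathbf U$ is a $\left(\frac{\epsilon\|\mathbf M\|_k}{\Gamma\lambda_k(\mathbf M)},\Gamma\right)$-$k$-cPCA of $\mathbf M$.
   Context: $\lambda_i(\mathbf M)$ is the $i$-th largest eigenvalue; $\|\mathbf M\|_k:=\sum_{i=1}^k\lambda_i(\mathbf M)$. $\mathbf U\in\mathbb R^{d\times k}$ is orthonormal if $\mathbf U^\top\mathbf U=\mathbf I_k$. $\mathbf V^{<\lambda}(\mathbf M)$ is an orthonormal matrix whose columns span the eigenspace of $\mathbf M$ for eigenvalues $<\lambda$. $\epsilon$-$k$-ePCA: an orthonormal $\mathbf U\in\mathbb R^{d\times k}$ with $\mathrm{Tr}(\mathbf U\mathbf U^\top\mathbf M)\ge(1-\epsilon)\|\mathbf M\|_k$. $(\Delta,\Gamma)$-$k$-cPCA: an orthonormal $\mathbf U\in\mathbb R^{d\times k}$ with $\|(\mathbf V^{<(1-\Gamma)\lambda_k(\mathbf M)}(\mathbf M))^\top\mathbf U\|_F^2\le\Delta$ (the inequality is trivially true if $\Delta\ge k$). *)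

theory Defs
  imports
    "Jordan_Normal_Form.Char_Poly"
    "Jordan_Normal_Form.Gram_Schmidt"
begin

definition symmetric_mat :: "real mat \<Rightarrow> bool" where
  "symmetric_mat M \<longleftrightarrow> M\<^sup>T = M"

definition psd_mat :: "real mat \<Rightarrow> bool" where
  "psd_mat M \<longleftrightarrow> (\<forall>x \<in> carrier_vec (dim_row M). 0 \<le> x \<bullet> (M *\<^sub>v x))"

definition orthonormal_mat :: "real mat \<Rightarrow> bool" where
  "orthonormal_mat U \<longleftrightarrow> U\<^sup>T * U = 1\<^sub>m (dim_col U)"

definition trace_mat :: "real mat \<Rightarrow> real" where
  "trace_mat A = (\<Sum>i<dim_row A. A $$ (i, i))"

definition frobenius_norm :: "real mat \<Rightarrow> real" where
  "frobenius_norm A = sqrt (\<Sum>i<dim_row A. \<Sum>j<dim_col A. (A $$ (i, j))\<^sup>2)"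

text \<open>The eigenvalues are listed with multiplicity. Only real roots of the characteristic
  polynomial are collected; for a symmetric matrix these are all of its roots, so the list then
  has as many entries as \<open>M\<close> has rows. Positions are counted from \<open>1\<close>.\<close>

definition eigenvalues_desc :: "real mat \<Rightarrow> real list" where
  "eigenvalues_desc M = rev (sorted_list_of_multiset (proots (char_poly M)))"

definition nth_eigenvalue :: "nat \<Rightarrow> real mat \<Rightarrow> real" where
  "nth_eigenvalue i M = eigenvalues_desc M ! (i - 1)"

definition top_eigenvalue_sum :: "nat \<Rightarrow> real mat \<Rightarrow> real" where
  "top_eigenvalue_sum k M = (\<Sum>i = 1..k. nth_eigenvalue i M)"

abbreviation vec_span :: "nat \<Rightarrow> real vec set \<Rightarrow> real vec set" where
  "vec_span n S \<equiv> LinearCombinations.module.span class_ring (module_vec TYPE(real) n) S"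

definition eigenspace_below :: "real \<Rightarrow> real mat \<Rightarrow> real vec set" where
  "eigenspace_below l M = vec_span (dim_row M) {v. \<exists>\<mu><l. eigenvector M v \<mu>}"

text \<open>The matrix \<open>V\<close> below is determined only up to the choice of an orthonormal basis, and it
  may have no columns at all. We therefore describe it by a predicate, and the notion of cPCA
  is required of every admissible \<open>V\<close>. The lemma \<open>ex_eigenspace_below_basis\<close>
  shows that an admissible \<open>V\<close> always exists.\<close>

definition eigenspace_below_basis :: "real \<Rightarrow> real mat \<Rightarrow> real mat \<Rightarrow> bool" where
  "eigenspace_below_basis l M V \<longleftrightarrow>
     dim_row V = dim_row M \<and> orthonormal_mat V \<and>
     vec_span (dim_row M) (set (cols V)) = eigenspace_below l M"

definition is_ePCA :: "real \<Rightarrow> nat \<Rightarrow> real mat \<Rightarrow> real mat \<Rightarrow> bool" where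
  "is_ePCA \<epsilon> k M U \<longleftrightarrow>
     U \<in> carrier_mat (dim_row M) k \<and> orthonormal_mat U \<and>
     trace_mat (U * U\<^sup>T * M) \<ge> (1 - \<epsilon>) * top_eigenvalue_sum k M"

definition is_cPCA :: "real \<Rightarrow> real \<Rightarrow> nat \<Rightarrow> real mat \<Rightarrow> real mat \<Rightarrow> bool" where
  "is_cPCA \<Delta> \<Gamma> k M U \<longleftrightarrow>
     U \<in> carrier_mat (dim_row M) k \<and> orthonormal_mat U \<and>
     (\<forall>V. eigenspace_below_basis ((1 - \<Gamma>) * nth_eigenvalue k M) M V \<longrightarrow>
        (frobenius_norm (V\<^sup>T * U))\<^sup>2 \<le> \<Delta>)"

lemma ex_orthonormal_mat_span:
  fixes E :: "real vec set"
  assumes E: "E \<subseteq> carrier_vec n"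
  shows "\<exists>V. dim_row V = n \<and> orthonormal_mat V \<and> vec_span n (set (cols V)) = vec_span n E"
proof -
  interpret cof_vec_space n "TYPE(real)" .
  obtain S where fS: "finite S" and mS: "maximal S (\<lambda>S. S \<subseteq> E \<and> lin_indpt S)"
  proof -
    have "\<exists>A. finite A \<and> maximal A (\<lambda>S. S \<subseteq> E \<and> lin_indpt S)"
    proof (rule maximal_exists[where B = "{}" and N = n])
      fix A assume "A \<subseteq> E \<and> lin_indpt A"
      then show "finite A \<and> card A \<le> n"
        using li_le_dim[OF fin_dim, of A] fin_dim_li_fin[OF fin_dim, of A] E dim_is_n by auto
    next
      show "{} \<subseteq> E \<and> lin_indpt {}" by (auto simp: lin_dep_def)
    qed
    then show ?thesis using that by blast
  qed
  have SE: "S \<subseteq> E" and liS: "lin_indpt S"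
    and mx: "\<And>B. S \<subseteq> B \<Longrightarrow> B \<subseteq> E \<Longrightarrow> lin_indpt B \<Longrightarrow> B = S"
    using mS unfolding maximal_def by auto
  have Sc: "S \<subseteq> carrier_vec n" using SE E by auto
  have "e \<in> span S" if "e \<in> E" for e
  proof (cases "e \<in> S")
    case True
    then show ?thesis using span_mem[OF Sc] by auto
  next
    case False
    then have "lin_dep (insert e S)" using mx[of "insert e S"] SE that by auto
    then show ?thesis using lin_dep_iff_in_span[OF Sc liS _ False] E that by auto
  qed
  then have sp: "span S = span E"
    using span_is_monotone[OF SE] span_is_subset[of E S] span_subsetI[OF Sc, of E] by auto
  obtain ws where ws: "set ws = S" "distinct ws" using fS finite_distinct_list by blast
  define us where "us = gram_schmidt n ws"
  note gs = gram_schmidt_result[of ws us, unfolded ws, OF Sc ws(2) liS us_def]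
  have pos: "u \<bullet> u > 0" if "u \<in> set us" for u
  proof -
    from that obtain i where i: "i < length us" "u = us ! i" by (auto simp: in_set_conv_nth)
    then have "u \<bullet>c u \<noteq> 0" using gs(2) unfolding corthogonal_def by blast
    then have "u \<bullet> u \<noteq> 0" by simp
    moreover have "u \<bullet> u \<ge> 0" by (auto simp: scalar_prod_def intro!: sum_nonneg)
    ultimately show ?thesis by simp
  qed
  define f where "f u = (1 / sqrt (u \<bullet> u)) \<cdot>\<^sub>v u" for u :: "real vec"
  define vs where "vs = map f us"
  have vc: "set vs \<subseteq> carrier_vec n" using gs(3) by (auto simp: vs_def f_def)
  have s1: "span (set vs) \<subseteq> span (set us)"
  proof (rule span_subsetI[OF gs(3)])
    show "set vs \<subseteq> span (set us)"
      using gs(3) span_mem[OF gs(3)] smult_in_span[OF gs(3)] by (force simp: vs_def f_def)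
  qed
  have s2: "span (set us) \<subseteq> span (set vs)"
  proof (rule span_subsetI[OF vc], rule subsetI)
    fix u assume u: "u \<in> set us"
    have "f u \<in> span (set vs)" using span_mem[OF vc] u by (auto simp: vs_def)
    then have "sqrt (u \<bullet> u) \<cdot>\<^sub>v f u \<in> span (set vs)" using smult_in_span[OF vc] by auto
    also have "sqrt (u \<bullet> u) \<cdot>\<^sub>v f u = u"
      using pos[OF u] by (auto simp: f_def smult_smult_assoc)
    finally show "u \<in> span (set vs)" .
  qed
  define V where "V = mat_of_cols n vs"
  have cV: "cols V = vs" unfolding V_def using vc by (simp add: cols_mat_of_cols)
  have "orthonormal_mat V" unfolding orthonormal_mat_def
  proof (rule eq_matI)
    fix i j assume "i < dim_row (1\<^sub>m (dim_col V) :: real mat)" "j < dim_col (1\<^sub>m (dim_col V) :: real mat)"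
    then have ij: "i < length us" "j < length us" by (auto simp: V_def vs_def)
    have "us ! i \<in> carrier_vec n" "us ! j \<in> carrier_vec n" using gs(3) ij by (auto simp: subset_iff)
    moreover have "us ! i \<bullet> us ! j = 0 \<longleftrightarrow> i \<noteq> j"
      using gs(2) ij unfolding corthogonal_def by simp
    moreover have "us ! i \<bullet> us ! i > 0" using pos ij by auto
    ultimately have "f (us ! i) \<bullet> f (us ! j) = (if i = j then 1 else 0)"
      unfolding f_def by (auto simp: field_simps)
    moreover have "col V i = f (us ! i)" "col V j = f (us ! j)"
      using ij vc by (auto simp: V_def vs_def col_mat_of_cols image_subset_iff)
    ultimately show "(V\<^sup>T * V) $$ (i, j) = 1\<^sub>m (dim_col V) $$ (i, j)"
      using ij by (auto simp: V_def vs_def)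
  qed auto
  moreover have "dim_row V = n" by (simp add: V_def)
  moreover have "span (set (cols V)) = span E" using cV s1 s2 gs(1) sp by simp
  ultimately show ?thesis by blast
qed

lemma ex_eigenspace_below_basis: "\<exists>V. eigenspace_below_basis l M V"
  using ex_orthonormal_mat_span[of "{v. \<exists>\<mu><l. eigenvector M v \<mu>}" "dim_row M"]
  unfolding eigenspace_below_basis_def eigenspace_below_def eigenvector_def by blast

end

theory Submission
  imports Defs
begin

text \<open>
  Fix an orthonormal eigenbasis of \<open>M\<close> with eigenvalues \<open>a i\<close> in descending order,
  and let \<open>w i\<close> be the squared length of the projection of the \<open>i\<close>-th basis vector to the column span
  of \<open>U\<close>. Then \<open>0 \<le> w i \<le> 1\<close>, the \<open>w i\<close> sum to \<open>k\<close>, and the trace of \<open>U U\<^sup>T M\<close> is the weighted sum of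
  the \<open>a i\<close> with weights \<open>w i\<close>. The ePCA condition thus bounds the loss, the amount by which this
  weighted sum falls short of the sum of the \<open>k\<close> largest eigenvalues, by \<open>\<epsilon>\<close> times the latter.

  Any weight on an eigenvalue below \<open>(1 - \<Gamma>) b\<close>, where \<open>b\<close> is the \<open>k\<close>-th largest eigenvalue, is weight
  that could sit on eigenvalues at least \<open>b\<close>, so it costs more than \<open>\<Gamma> b\<close> per unit
  (\<open>top_sum_minus_weighted_sum_ge\<close>). Hence the total weight on those eigenvalues is at most the loss
  divided by \<open>\<Gamma> b\<close>. This total weight bounds the squared Frobenius norm of \<open>V\<^sup>T U\<close> for every admissible
  \<open>V\<close>: the columns of \<open>V\<close> are orthogonal to the other eigenvectors
  (\<open>eigenspace_below_basis_orthogonal\<close>), so only the components of \<open>U\<close> along the low eigenvectors are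
  seen, and projecting to the span of \<open>V\<close> does not increase norms (\<open>frobenius_norm_sq_orthonormal_le\<close>).

  The eigenvalues in the statement are roots of the characteristic polynomial. That they are \<open>d\<close> real
  numbers and appear, in this order, as the diagonal of an orthogonal diagonalization is the spectral
  theorem, \<open>symmetric_orthogonal_diagonalization\<close>.
\<close>

section \<open>The spectral theorem for real symmetric matrices\<close>

text \<open>For \<open>A v = z v\<close> with complex \<open>v\<close>, moving the real symmetric matrix across the
  Hermitian form gives \<open>z \<langle>v, v\<rangle> = cnj z \<langle>v, v\<rangle>\<close>, and \<open>\<langle>v, v\<rangle> \<noteq> 0\<close>.\<close>

lemma symmetric_complex_root_real:
  fixes A :: "real mat"
  assumes A: "A \<in> carrier_mat n n" and sym: "A\<^sup>T = A"
    and root: "poly (map_poly complex_of_real (char_poly A)) z = 0"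
  shows "z \<in> \<real>"
proof -
  define B where "B = map_mat complex_of_real A"
  have B: "B \<in> carrier_mat n n" using A by (simp add: B_def)
  have BT: "B\<^sup>T = B" unfolding B_def by (simp add: map_mat_transpose sym)
  have "poly (char_poly B) z = 0"
    using root by (simp add: B_def of_real_hom.char_poly_hom[OF A])
  then obtain v where ev: "eigenvector B v z"
    using eigenvalue_root_char_poly[OF B] unfolding eigenvalue_def by blast
  then have v: "v \<in> carrier_vec n" "v \<noteq> 0\<^sub>v n" and Bv: "B *\<^sub>v v = z \<cdot>\<^sub>v v"
    using B unfolding eigenvector_def by auto
  have "B *\<^sub>v conjugate v = conjugate (B *\<^sub>v v)"
    using A v by (intro eq_vecI) (auto simp: B_def scalar_prod_def)
  then have Bcv: "B *\<^sub>v conjugate v = conjugate z \<cdot>\<^sub>v conjugate v"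
    using v by (simp add: Bv conjugate_smult_vec)
  have "z * (v \<bullet>c v) = (B *\<^sub>v v) \<bullet>c v"
    using v by (simp add: Bv)
  also have "\<dots> = v \<bullet> (B *\<^sub>v conjugate v)"
    using transpose_vec_mult_scalar[OF B, of "conjugate v" v] v BT 
    by (metis B carrier_vec_conjugate comm_scalar_prod mult_mat_vec_carrier)
  also have "\<dots> = cnj z * (v \<bullet>c v)"
    using v by (simp add: Bcv)
  finally have "z = cnj z" using v by simp
  then show ?thesis by (metis Reals_cnj_iff)
qed

text \<open>Over \<open>\<complex>\<close> the characteristic polynomial splits; since its roots are real, the factorization
  is the image of one over \<open>\<real>\<close>.\<close>

lemma symmetric_char_poly_splits:
  fixes A :: "real mat"
  assumes A: "A \<in> carrier_mat n n" and sym: "A\<^sup>T = A"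
  shows "\<exists>es. char_poly A = (\<Prod>e\<leftarrow>es. [:- e, 1:])"
proof -
  interpret poly_hom: map_poly_inj_idom_hom complex_of_real ..
  have "char_poly (map_mat complex_of_real A) = map_poly of_real (char_poly A)"
    by (rule of_real_hom.char_poly_hom[OF A])
  then obtain zs where zs: "map_poly complex_of_real (char_poly A) = (\<Prod>z\<leftarrow>zs. [:- z, 1:])"
    using char_poly_factorized[of "map_mat complex_of_real A" n] A by auto
  have "z \<in> \<real>" if "z \<in> set zs" for z
  proof (rule symmetric_complex_root_real[OF A sym])
    show "poly (map_poly complex_of_real (char_poly A)) z = 0"
      using that unfolding zs by (simp add: poly_prod_list prod_list_zero_iff)
  qed
  then have "map complex_of_real (map Re zs) = zs"
    by (simp add: map_idI)
  then have "map_poly complex_of_real (char_poly A)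
      = (\<Prod>z\<leftarrow>map complex_of_real (map Re zs). [:- z, 1:])"
    using zs by simp
  also have "\<dots> = map_poly complex_of_real (\<Prod>e\<leftarrow>map Re zs. [:- e, 1:])"
    by (simp add: poly_hom.hom_prod_list o_def)
  finally show ?thesis
    by (metis poly_hom.eq_iff)
qed

text \<open>The list of real roots loses nothing for a symmetric matrix: it is a complete factorization of
  the characteristic polynomial, and so it can be used as the diagonal in the spectral theorem.\<close>

lemma symmetric_eigenvalues_desc:
  assumes A: "A \<in> carrier_mat n n" and sym: "A\<^sup>T = A"
  shows "char_poly A = (\<Prod>e\<leftarrow>eigenvalues_desc A. [:- e, 1:])"
    and "length (eigenvalues_desc A) = n"
    and "sorted_wrt (\<ge>) (eigenvalues_desc A)"
proof -
  obtain es where es: "char_poly A = (\<Prod>e\<leftarrow>es. [:- e, 1:])"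
    using symmetric_char_poly_splits[OF A sym] by blast
  have "proots (char_poly A) = mset es"
    unfolding es
  proof (induction es)
    case (Cons e es)
    have "(\<Prod>e\<leftarrow>es. [:- e, 1:]) \<noteq> 0" by (auto simp: prod_list_zero_iff)
    then show ?case using Cons by (simp add: proots_mult del: mult_pCons_left)
  qed simp
  then have m: "mset (eigenvalues_desc A) = mset es"
    by (simp add: eigenvalues_desc_def)
  have "(\<Prod>e\<leftarrow>es. [:- e, 1:]) = prod_mset (image_mset (\<lambda>e. [:- e, 1:]) (mset es))"
    by (metis mset_map prod_mset_prod_list)
  also have "\<dots> = (\<Prod>e\<leftarrow>eigenvalues_desc A. [:- e, 1:])"
    by (metis m mset_map prod_mset_prod_list)
  finally show c: "char_poly A = (\<Prod>e\<leftarrow>eigenvalues_desc A. [:- e, 1:])"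
    using es by simp
  show "length (eigenvalues_desc A) = n"
    using degree_monic_char_poly[OF A] degree_linear_factors[of uminus "eigenvalues_desc A"] c 
    by simp
  show "sorted_wrt (\<ge>) (eigenvalues_desc A)"
    by (simp add: eigenvalues_desc_def sorted_wrt_rev)
qed

text \<open>Unless \<open>x\<close> is the first unit vector \<open>e\<^sub>0\<close> itself, the Householder reflection in the hyperplane
  orthogonal to \<open>u = x - e\<^sub>0\<close> swaps the two. It replaces the completion of \<open>x\<close> to an orthonormal basis, and being
  its own transpose and inverse it makes conjugation by it immediate.\<close>

lemma orthogonal_involution_with_first_column:
  fixes x :: "real vec"
  assumes x: "x \<in> carrier_vec n" and unit: "x \<bullet> x = 1" and n: "0 < n"
  shows "\<exists>W \<in> carrier_mat n n. W\<^sup>T = W \<and> W * W = 1\<^sub>m n \<and> col W 0 = x"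
proof (cases "x = unit_vec n 0")
  case True
  then show ?thesis using n by (intro bexI[of _ "1\<^sub>m n"]) auto
next
  case False
  define u where "u i = x $ i - (if i = 0 then 1 else 0)" for i
  \<comment> \<open>For a unit vector \<open>x\<close>, \<open>s\<close> is half of \<open>u \<bullet> u\<close>, the usual factor \<open>2 / (u \<bullet> u)\<close> being \<open>1 / s\<close>.\<close>
  define s where "s = 1 - x $ 0"
  have x2: "(\<Sum>k<n. x $ k * x $ k) = 1"
    using x unit by (simp add: scalar_prod_def atLeast0LessThan)
  have "(\<Sum>k<n. u k * u k) = (\<Sum>k<n. x $ k * x $ k + (if k = 0 then 1 - 2 * x $ 0 else 0))"
    by (rule sum.cong) (auto simp: u_def algebra_simps)
  then have u2: "(\<Sum>k<n. u k * u k) = 2 * s"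
    using x2 n by (simp add: sum.distrib s_def)
  have s0: "s \<noteq> 0"
  proof
    assume "s = 0"
    then have "\<forall>k\<in>{..<n}. u k * u k = 0"
      using u2 by (subst sum_nonneg_eq_0_iff[symmetric]) auto
    then have "x = unit_vec n 0" using x n by (intro eq_vecI) (auto simp: u_def)
    with False show False ..
  qed
  define W where "W = mat n n (\<lambda>(i, j). (if i = j then 1 else 0) - u i * u j / s)"
  have W: "W \<in> carrier_mat n n" by (simp add: W_def)
  moreover have "W\<^sup>T = W" by (rule eq_matI) (auto simp: W_def)
  moreover have "W * W = 1\<^sub>m n"
  proof (rule eq_matI)
    fix i j assume "i < dim_row (1\<^sub>m n :: real mat)" "j < dim_col (1\<^sub>m n :: real mat)"
    then have ij: "i < n" "j < n" by auto
    have "(W * W) $$ (i, j) = (\<Sum>k<n. ((if i = k then 1 else 0) - u i * u k / s)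
        * ((if k = j then 1 else 0) - u k * u j / s))"
      using ij by (simp add: W_def scalar_prod_def atLeast0LessThan)
    also have "\<dots> = (\<Sum>k<n. (if i = k then (if i = j then 1 else 0) - u i * u j / s else 0)
        - (if k = j then u i * u j / s else 0) + (u i * u j / (s * s)) * (u k * u k))"
      by (rule sum.cong) (auto simp: algebra_simps)
    also have "\<dots> = (if i = j then 1 else 0) - u i * u j / s - u i * u j / s
        + (u i * u j / (s * s)) * (\<Sum>k<n. u k * u k)"
      using ij unfolding sum.distrib sum_subtractf sum_distrib_left[symmetric] by simp
    also have "\<dots> = (if i = j then 1 else 0)"
      using s0 by (simp add: u2)
    finally show "(W * W) $$ (i, j) = 1\<^sub>m n $$ (i, j)" using ij by simp
  qed (use W in auto)
  moreover have "col W 0 = x"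
  proof (rule eq_vecI)
    fix i assume "i < dim_vec x"
    then show "col W 0 $ i = x $ i"
      using x n s0 by (auto simp: W_def u_def s_def field_simps)
  qed (use W x in auto)
  ultimately show ?thesis by blast
qed

text \<open>Spectral theorem, by deflation. A unit eigenvector for the first root is made the first column
  of a symmetric orthogonal matrix \<open>W\<close>. In \<open>W A W\<close> the first column is then a multiple of the first unit
  vector, and by symmetry so is the first row; the remaining block is symmetric and its characteristic
  polynomial is the product over the remaining roots. Since the diagonal is prescribed by the given list
  of roots, in the given order, the diagonal entries can be taken in descending order.\<close>

lemma symmetric_orthogonal_diagonalization:
  fixes A :: "real mat"
  assumes "A \<in> carrier_mat n n" and "A\<^sup>T = A"
    and "char_poly A = (\<Prod>e\<leftarrow>es. [:- e, 1:])"
  shows "\<exists>Q \<in> carrier_mat n n. Q\<^sup>T * Q = 1\<^sub>m n \<and> A * Q = Q * mat_diag n ((!) es)"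
  using assms
proof (induction es arbitrary: n A)
  case Nil
  then have "n = 0" using degree_monic_char_poly[of A n] by simp
  with Nil show ?case by (intro bexI[of _ "1\<^sub>m n"] conjI eq_matI) (auto simp: mat_diag_def)
next
  case (Cons e es)
  note A = Cons.prems(1) and sym = Cons.prems(2) and c = Cons.prems(3)
  define m where "m = length es"
  have n: "n = Suc m"
    using degree_monic_char_poly[OF A] degree_linear_factors[of uminus "e # es"]
    unfolding c m_def by simp
  have "eigenvalue A e"
    unfolding eigenvalue_root_char_poly[OF A] c by simp
  then obtain v where v: "v \<in> carrier_vec n" "v \<noteq> 0\<^sub>v n" "A *\<^sub>v v = e \<cdot>\<^sub>v v"
    using A unfolding eigenvalue_def eigenvector_def by auto
  define x where "x = (1 / sqrt (v \<bullet> v)) \<cdot>\<^sub>v v"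
  have "v \<bullet> v > 0"
    using conjugate_square_greater_0_vec[OF v(1)] v(2) by simp
  then have x: "x \<in> carrier_vec n" "x \<bullet> x = 1" "A *\<^sub>v x = e \<cdot>\<^sub>v x"
    using v A by (auto simp: x_def mult_mat_vec smult_smult_assoc mult.commute)
  obtain W where W: "W \<in> carrier_mat n n" "W\<^sup>T = W" "W * W = 1\<^sub>m n" "col W 0 = x"
    using orthogonal_involution_with_first_column[OF x(1,2)] n by blast
  define B where "B = W * A * W"
  have B: "B \<in> carrier_mat n n" using A W by (simp add: B_def)
  have BT: "B\<^sup>T = B"
    unfolding B_def using A W sym
    by (simp add: transpose_mult[of _ n n _ n] assoc_mult_mat[of _ n n _ n _ n])
  have "col B 0 = W *\<^sub>v (A *\<^sub>v col W 0)"
    unfolding B_def using assoc_mult_mat[OF W(1) A W(1)] col_mult2[OF W(1) mult_carrier_mat[OF A W(1)]]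
      col_mult2[OF A W(1)] n by simp
  also have "\<dots> = e \<cdot>\<^sub>v (W *\<^sub>v x)"
    using W x by (simp add: mult_mat_vec)
  also have "W *\<^sub>v x = col (W * W) 0"
    using col_mult2[OF W(1) W(1)] W(4) n by simp
  finally have colB: "col B 0 = e \<cdot>\<^sub>v unit_vec n 0"
    using W(3) n by simp
  have B0: "B $$ (i, 0) = (if i = 0 then e else 0)" if "i < n" for i
    using arg_cong[OF colB, of "\<lambda>y. y $ i"] that n B by auto
  have B0': "B $$ (0, j) = (if j = 0 then e else 0)" if "j < n" for j
    using B0[OF that] BT B that n by (metis carrier_matD index_transpose_mat(1) zero_less_Suc)
  define C where "C = mat m m (\<lambda>(i, j). B $$ (Suc i, Suc j))"
  have C: "C \<in> carrier_mat m m" by (simp add: C_def)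
  have CT: "C\<^sup>T = C"
  proof (rule eq_matI)
    fix i j assume "i < dim_row C" "j < dim_col C"
    then have ij: "i < m" "j < m" using C by auto
    then have "B\<^sup>T $$ (Suc i, Suc j) = B $$ (Suc j, Suc i)" using B n by simp
    then show "C\<^sup>T $$ (i, j) = C $$ (i, j)" using ij by (simp add: C_def BT)
  qed (use C in auto)
  define E where "E = mat 1 1 (\<lambda>_. e)"
  have E: "E \<in> carrier_mat 1 1" by (simp add: E_def)
  have Bblock: "B = four_block_mat E (0\<^sub>m 1 m) (0\<^sub>m m 1) C"
    by (rule eq_matI) (use B n in \<open>auto simp: E_def C_def B0 B0'\<close>)
  have "char_poly A = char_poly B"
  proof (rule char_poly_similar, rule similar_matI)
    show "A = W * B * W"
    proof -
      have "W * B * W = (W * W) * A * (W * W)"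
        using A W(1) by (simp add: B_def assoc_mult_mat[of _ n n _ n _ n])
      then show ?thesis using A W(3) by simp
    qed
  qed (use A B W in auto)
  also have "\<dots> = char_poly E * char_poly C"
    unfolding Bblock by (rule char_poly_four_block_zeros_col[OF E _ C]) simp
  also have "char_poly E = [:- e, 1:]"
    using char_poly_upper_triangular[OF E] by (simp add: E_def upper_triangular_def diag_mat_def)
  finally have "[:- e, 1:] * char_poly C = [:- e, 1:] * (\<Prod>e\<leftarrow>es. [:- e, 1:])"
    using c by simp
  then have "char_poly C = (\<Prod>e\<leftarrow>es. [:- e, 1:])"
    unfolding mult_cancel_left by simp
  from Cons.IH[OF C CT this] obtain R where R: "R \<in> carrier_mat m m" "R\<^sup>T * R = 1\<^sub>m m"
    "C * R = R * mat_diag m ((!) es)" by blast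
  define S where "S = four_block_mat (1\<^sub>m 1) (0\<^sub>m 1 m) (0\<^sub>m m 1) R"
  have S: "S \<in> carrier_mat n n"
    using four_block_carrier_mat[of "1\<^sub>m 1" 1 1 R m m] R(1) n by (simp add: S_def)
  have "S\<^sup>T = four_block_mat (1\<^sub>m 1) (0\<^sub>m 1 m) (0\<^sub>m m 1) R\<^sup>T"
    unfolding S_def by (subst transpose_four_block_mat[of _ 1 1 _ m _ m]) (use R in auto)
  then have "S\<^sup>T * S = four_block_mat (1\<^sub>m 1) (0\<^sub>m 1 m) (0\<^sub>m m 1) (1\<^sub>m m)"
    unfolding S_def by (simp, subst mult_four_block_mat[of _ 1 1 _ m _ m _ _ 1 _ m]) (use R in auto)
  then have STS: "S\<^sup>T * S = 1\<^sub>m n" using n by simp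
  have D: "mat_diag n ((!) (e # es)) = four_block_mat E (0\<^sub>m 1 m) (0\<^sub>m m 1) (mat_diag m ((!) es))"
    by (rule eq_matI) (auto simp: mat_diag_def E_def n)
  have "B * S = four_block_mat E (0\<^sub>m 1 m) (0\<^sub>m m 1) (C * R)"
    unfolding Bblock S_def
    by (subst mult_four_block_mat[of _ 1 1 _ m _ m _ _ 1 _ m]) (use R C E in auto)
  also have "\<dots> = S * mat_diag n ((!) (e # es))"
    unfolding D S_def R(3)
    by (subst mult_four_block_mat[of _ 1 1 _ m _ m _ _ 1 _ m]) (use R E in \<open>auto simp: left_mult_zero_mat[OF mat_diag_dim]\<close>)
  finally have BS: "B * S = S * mat_diag n ((!) (e # es))" .
  have "(W * S)\<^sup>T * (W * S) = S\<^sup>T * ((W * W) * S)"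
    using W(1,2) S by (simp add: transpose_mult[of _ n n _ n] assoc_mult_mat[of _ n n _ n _ n])
  then have orth: "(W * S)\<^sup>T * (W * S) = 1\<^sub>m n" using W(3) S STS by simp
  have "A * (W * S) = (W * W) * (A * (W * S))" using A S W by simp
  also have "\<dots> = W * (B * S)"
    using A W(1) S by (simp add: B_def assoc_mult_mat[of _ n n _ n _ n])
  also have "\<dots> = (W * S) * mat_diag n ((!) (e # es))"
    unfolding BS using W(1) S by (simp add: assoc_mult_mat[of _ n n _ n _ n])
  finally show ?case using orth W(1) S by (intro bexI[of _ "W * S"]) auto
qed

section \<open>Orthonormal columns and the Frobenius norm\<close>

text \<open>The vector \<open>V V\<^sup>T x\<close> is the orthogonal projection of \<open>x\<close> to the span of the columns, so that
  the difference of the two sides is the squared length of \<open>x - V V\<^sup>T x\<close>.\<close>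

lemma bessel_inequality:
  fixes V :: "real mat"
  assumes V: "V \<in> carrier_mat n r" and orth: "V\<^sup>T * V = 1\<^sub>m r" and x: "x \<in> carrier_vec n"
  shows "(V\<^sup>T *\<^sub>v x) \<bullet> (V\<^sup>T *\<^sub>v x) \<le> x \<bullet> x"
proof -
  define y where "y = V\<^sup>T *\<^sub>v x"
  define z where "z = V *\<^sub>v y"
  have y: "y \<in> carrier_vec r" and z: "z \<in> carrier_vec n"
    using V x by (auto simp: y_def z_def)
  have xz: "x \<bullet> z = y \<bullet> y"
    using transpose_vec_mult_scalar[OF V y x] by (simp add: y_def z_def)
  have "V\<^sup>T *\<^sub>v z = (V\<^sup>T * V) *\<^sub>v y"
    using V y by (simp add: z_def assoc_mult_mat_vec[of _ r n _ r])
  then have zz: "z \<bullet> z = y \<bullet> y"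
    using transpose_vec_mult_scalar[OF V y z] y by (simp add: orth z_def[symmetric])
  have "0 \<le> (x - z) \<bullet> (x - z)"
    by (auto simp: scalar_prod_def intro!: sum_nonneg)
  also have "\<dots> = x \<bullet> x - y \<bullet> y"
    using x z xz zz comm_scalar_prod[OF x z]
    by (simp add: minus_scalar_prod_distrib[of _ n] scalar_prod_minus_distrib[of _ n])
  finally show ?thesis by (simp add: y_def)
qed

lemma frobenius_norm_sq: "(frobenius_norm A)\<^sup>2 = (\<Sum>i<dim_row A. \<Sum>j<dim_col A. (A $$ (i, j))\<^sup>2)"
  by (simp add: frobenius_norm_def sum_nonneg)

text \<open>Bessel's inequality for each column of \<open>B\<close>.\<close>

lemma frobenius_norm_sq_orthonormal_le:
  assumes V: "V \<in> carrier_mat n r" and orth: "V\<^sup>T * V = 1\<^sub>m r" and B: "B \<in> carrier_mat n m"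
  shows "(frobenius_norm (V\<^sup>T * B))\<^sup>2 \<le> (frobenius_norm B)\<^sup>2"
proof -
  have cols: "(frobenius_norm C)\<^sup>2 = (\<Sum>j<m. col C j \<bullet> col C j)" if "C \<in> carrier_mat p m" for C p
    using that unfolding frobenius_norm_sq
    by (subst sum.swap) (auto simp: scalar_prod_def power2_eq_square atLeast0LessThan intro!: sum.cong)
  have "(frobenius_norm (V\<^sup>T * B))\<^sup>2 = (\<Sum>j<m. (V\<^sup>T *\<^sub>v col B j) \<bullet> (V\<^sup>T *\<^sub>v col B j))"
    using V B by (subst cols[of _ r]) (auto simp: mult_mat_vec_def)
  also have "\<dots> \<le> (\<Sum>j<m. col B j \<bullet> col B j)"
    using B by (intro sum_mono bessel_inequality[OF V orth]) auto
  also have "\<dots> = (frobenius_norm B)\<^sup>2" using cols[OF B] by simp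
  finally show ?thesis .
qed

lemma trace_mat_mult_commute:
  assumes "A \<in> carrier_mat n m" and "B \<in> carrier_mat m n"
  shows "trace_mat (A * B) = trace_mat (B * A)"
proof -
  have "trace_mat (A * B) = (\<Sum>i<n. \<Sum>j<m. A $$ (i, j) * B $$ (j, i))"
    using assms by (auto simp: trace_mat_def scalar_prod_def atLeast0LessThan)
  also have "\<dots> = (\<Sum>j<m. \<Sum>i<n. B $$ (j, i) * A $$ (i, j))"
    by (subst sum.swap) (simp add: mult.commute)
  also have "\<dots> = trace_mat (B * A)"
    using assms by (auto simp: trace_mat_def scalar_prod_def atLeast0LessThan)
  finally show ?thesis .
qed

section \<open>Orthogonality to the low eigenspace\<close>

lemma orthogonal_to_vec_span:
  assumes S: "S \<subseteq> carrier_vec n" and q: "q \<in> carrier_vec n"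
    and orth: "\<And>s. s \<in> S \<Longrightarrow> s \<bullet> q = 0" and v: "v \<in> vec_span n S"
  shows "v \<bullet> q = 0"
proof -
  interpret cof_vec_space n "TYPE(real)" .
  obtain a T where T: "v = lincomb a T" "finite T" "T \<subseteq> S"
    using in_spanE[OF v] by blast
  have "v \<bullet> q = (\<Sum>t\<in>T. (a t \<cdot>\<^sub>v t) \<bullet> q)"
    unfolding T(1) lincomb_def using T(3) S q by (subst finsum_scalar_prod_sum) auto
  also have "\<dots> = 0"
    using T(3) S q orth by (intro sum.neutral) (auto simp: subset_iff)
  finally show ?thesis .
qed

lemma symmetric_eigenvectors_orthogonal:
  fixes M :: "real mat"
  assumes M: "M \<in> carrier_mat d d" and sym: "M\<^sup>T = M"
    and p: "p \<in> carrier_vec d" "M *\<^sub>v p = \<mu> \<cdot>\<^sub>v p"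
    and q: "q \<in> carrier_vec d" "M *\<^sub>v q = \<nu> \<cdot>\<^sub>v q" and ne: "\<mu> \<noteq> \<nu>"
  shows "p \<bullet> q = 0"
proof -
  have "\<mu> * (p \<bullet> q) = \<nu> * (p \<bullet> q)"
    using transpose_vec_mult_scalar[OF M q(1) p(1)] p q by (simp add: sym)
  with ne show ?thesis by simp
qed

text \<open>Each column of an admissible \<open>V\<close> is a combination of eigenvectors with eigenvalue below the
  threshold \<open>l\<close>, and these are orthogonal to any eigenvector with eigenvalue at least \<open>l\<close>.\<close>

lemma eigenspace_below_basis_orthogonal:
  assumes M: "M \<in> carrier_mat d d" and sym: "M\<^sup>T = M"
    and V: "eigenspace_below_basis l M V"
    and q: "q \<in> carrier_vec d" "M *\<^sub>v q = \<nu> \<cdot>\<^sub>v q" and "l \<le> \<nu>" and j: "j < dim_col V"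
  shows "q \<bullet> col V j = 0"
proof -
  interpret cof_vec_space d "TYPE(real)" .
  have dV: "dim_row V = d" using V M by (simp add: eigenspace_below_basis_def)
  then have c: "set (cols V) \<subseteq> carrier_vec d" using cols_dim[of V] by simp
  have "col V j \<in> set (cols V)" using j by (simp add: cols_def)
  then have "col V j \<in> span (set (cols V))" using span_mem[OF c] by simp
  then have "col V j \<in> vec_span d {v. \<exists>\<mu><l. eigenvector M v \<mu>}"
    using V M by (simp add: eigenspace_below_basis_def eigenspace_below_def)
  then have "col V j \<bullet> q = 0"
  proof (rule orthogonal_to_vec_span[rotated 3])
    fix s assume "s \<in> {v. \<exists>\<mu><l. eigenvector M v \<mu>}"
    then obtain \<mu> where "\<mu> < l" "s \<in> carrier_vec d" "M *\<^sub>v s = \<mu> \<cdot>\<^sub>v s"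
      using M unfolding eigenvector_def by auto
    then show "s \<bullet> q = 0"
      using symmetric_eigenvectors_orthogonal[OF M sym _ _ q] \<open>l \<le> \<nu>\<close> by simp
  qed (use q M in \<open>auto simp: eigenvector_def\<close>)
  moreover have "col V j \<in> carrier_vec d" using dV by (intro carrier_vecI) simp
  ultimately show ?thesis using comm_scalar_prod[OF q(1)] by simp
qed

section \<open>A weighted sum of eigenvalues compared with the top sum\<close>

text \<open>Since the weights \<open>w i\<close> sum to \<open>k\<close>, both sums on the right can be taken of \<open>a i - b\<close> with
  \<open>b = a (k - 1)\<close>: their difference is the sum of \<open>(a i - b) (1 - w i)\<close> over \<open>i < k\<close> and of
  \<open>(b - a i) w i\<close> over \<open>i \<ge> k\<close>. All these terms are nonnegative, and each index with \<open>a i < b - g\<close>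
  is of the second kind and contributes at least \<open>g w i\<close>. The indices start at \<open>0\<close>, so \<open>b\<close> is the
  \<open>k\<close>-th largest value.\<close>

lemma top_sum_minus_weighted_sum_ge:
  fixes a w :: "nat \<Rightarrow> real"
  assumes k: "1 \<le> k" "k \<le> d"
    and anti: "\<And>i j. i \<le> j \<Longrightarrow> j < d \<Longrightarrow> a j \<le> a i"
    and w: "\<And>i. i < d \<Longrightarrow> 0 \<le> w i" "\<And>i. i < d \<Longrightarrow> w i \<le> 1"
    and sum_w: "(\<Sum>i<d. w i) = real k" and g: "0 \<le> g"
  shows "g * (\<Sum>i<d. if a i < a (k - 1) - g then w i else 0)
    \<le> (\<Sum>i<k. a i) - (\<Sum>i<d. a i * w i)"
proof -
  define b where "b = a (k - 1)"
  \<comment> \<open>The weights of the extremal choice, for which the weighted sum is the sum of the top \<open>k\<close> values.\<close>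
  define h :: "nat \<Rightarrow> real" where "h i = (if i < k then 1 else 0)" for i
  have restrict: "(\<Sum>i<d. h i * f i) = (\<Sum>i<k. f i)" for f
  proof -
    have "(\<Sum>i<d. h i * f i) = (\<Sum>i<k. h i * f i)"
      by (rule sum.mono_neutral_right) (use k in \<open>auto simp: h_def\<close>)
    then show ?thesis by (simp add: h_def)
  qed
  have "g * (\<Sum>i<d. if a i < b - g then w i else 0) = (\<Sum>i<d. g * (if a i < b - g then w i else 0))"
    by (rule sum_distrib_left)
  also have "\<dots> \<le> (\<Sum>i<d. (a i - b) * (h i - w i))"
  proof (rule sum_mono)
    fix i assume "i \<in> {..<d}"
    then have i: "i < d" by simp
    show "g * (if a i < b - g then w i else 0) \<le> (a i - b) * (h i - w i)"
    proof (cases "i < k")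
      case True
      then have "b \<le> a i" using anti[of i "k - 1"] k by (simp add: b_def)
      then show ?thesis using True w(2)[OF i] g by (simp add: h_def)
    next
      case False
      then have "0 \<le> (b - a i) * w i"
        using anti[of "k - 1" i] i w(1)[OF i] by (simp add: b_def)
      moreover have "g * w i \<le> (b - a i) * w i" if "a i < b - g"
        using that w(1)[OF i] by (intro mult_right_mono) auto
      ultimately show ?thesis using False by (simp add: h_def algebra_simps)
    qed
  qed
  also have "\<dots> = (\<Sum>i<d. h i * a i) - (\<Sum>i<d. a i * w i) - b * ((\<Sum>i<d. h i * 1) - (\<Sum>i<d. w i))"
    by (simp add: sum_distrib_left sum_subtractf[symmetric] algebra_simps)
  also have "\<dots> = (\<Sum>i<k. a i) - (\<Sum>i<d. a i * w i)"
    unfolding restrict sum_w by simp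
  finally show ?thesis by (simp add: b_def)
qed

section \<open>From the trace bound to the low eigenspace\<close>

theorem lemma1:
  fixes M U :: "real mat" and d k :: nat and \<epsilon> \<Gamma> :: real
  assumes "M \<in> carrier_mat d d"
    and "symmetric_mat M"
    and "psd_mat M"
    and "k \<in> {1..d}"
    and "nth_eigenvalue k M > 0"
    and "\<epsilon> \<in> {0..1}"
    and "is_ePCA \<epsilon> k M U"
    and "\<Gamma> \<in> {0<..<1}"
  shows "is_cPCA (\<epsilon> * top_eigenvalue_sum k M / (\<Gamma> * nth_eigenvalue k M)) \<Gamma> k M U"
proof -
  note M = assms(1)
  have sym: "M\<^sup>T = M" using assms(2) by (simp add: symmetric_mat_def)
  have k: "1 \<le> k" "k \<le> d" using assms(4) by auto
  have U: "U \<in> carrier_mat d k" and U_orth: "orthonormal_mat U" and UTU: "U\<^sup>T * U = 1\<^sub>m k"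
    and trace_ge: "(1 - \<epsilon>) * top_eigenvalue_sum k M \<le> trace_mat (U * U\<^sup>T * M)"
    using assms(7) M by (auto simp: is_ePCA_def orthonormal_mat_def)
  define es where "es = eigenvalues_desc M"
  define b where "b = nth_eigenvalue k M"
  have b_nth: "b = es ! (k - 1)" and b_pos: "b > 0" and \<Gamma>: "0 < \<Gamma>"
    using assms(5,8) by (auto simp: b_def es_def nth_eigenvalue_def)
  have es_anti: "es ! j \<le> es ! i" if "i \<le> j" "j < d" for i j
    using symmetric_eigenvalues_desc[OF M sym] that sorted_wrt_nth_less[of "(\<ge>)" es i j]
    by (auto simp: es_def order.order_iff_strict)
  have top_sum: "top_eigenvalue_sum k M = (\<Sum>i<k. es ! i)"
    unfolding top_eigenvalue_sum_def nth_eigenvalue_def es_def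
    by (rule sum.reindex_bij_witness[of _ Suc "\<lambda>i. i - 1"]) auto
  obtain Q where Q: "Q \<in> carrier_mat d d" and QTQ: "Q\<^sup>T * Q = 1\<^sub>m d"
    and MQ: "M * Q = Q * mat_diag d ((!) es)"
    using symmetric_orthogonal_diagonalization[OF M sym] symmetric_eigenvalues_desc(1)[OF M sym]
    unfolding es_def by blast
  have QQT: "Q * Q\<^sup>T = 1\<^sub>m d"
    using mat_mult_left_right_inverse[OF _ Q QTQ] Q by simp
  have q_eigen: "M *\<^sub>v col Q i = es ! i \<cdot>\<^sub>v col Q i" if "i < d" for i
  proof -
    have "M *\<^sub>v col Q i = col (Q * mat_diag d ((!) es)) i"
      using col_mult2[OF M Q that] MQ by simp
    also have "\<dots> = es ! i \<cdot>\<^sub>v col Q i"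
      using Q that by (intro eq_vecI) (auto simp: mat_diag_mult_right[OF Q])
    finally show ?thesis .
  qed

  \<comment> \<open>The coordinates of the columns of \<open>U\<close> in the eigenbasis; \<open>w i\<close> is the squared length of the
    projection of the \<open>i\<close>-th eigenvector to the span of \<open>U\<close>.\<close>
  define N where "N = Q\<^sup>T * U"
  have N: "N \<in> carrier_mat d k" using Q U by (simp add: N_def)
  have QN: "Q * N = U"
    using Q U QQT by (simp add: N_def assoc_mult_mat[of Q d d "Q\<^sup>T" d U k, symmetric])
  have NT: "N\<^sup>T = U\<^sup>T * Q" using Q U by (simp add: N_def transpose_mult[of _ d d _ k])
  have NTN: "N\<^sup>T * N = 1\<^sub>m k"
    unfolding NT using assoc_mult_mat[OF _ Q N, of "U\<^sup>T" k] U by (simp add: QN UTU)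
  define w where "w i = (\<Sum>j<k. (N $$ (i, j))\<^sup>2)" for i
  have w_nonneg: "0 \<le> w i" for i by (simp add: w_def sum_nonneg)
  have w_le_1: "w i \<le> 1" if i: "i < d" for i
  proof -
    have "N\<^sup>T *\<^sub>v unit_vec d i = row N i"
      using N i by (intro eq_vecI) auto
    then have "row N i \<bullet> row N i \<le> 1"
      using bessel_inequality[OF N NTN, of "unit_vec d i"] i by simp
    then show ?thesis
      using N i by (simp add: w_def scalar_prod_def power2_eq_square atLeast0LessThan)
  qed
  have sum_w: "(\<Sum>i<d. w i) = real k"
  proof -
    have "(\<Sum>i<d. w i) = trace_mat (N\<^sup>T * N)"
      using N unfolding w_def trace_mat_def
      by (subst sum.swap) (auto simp: scalar_prod_def power2_eq_square atLeast0LessThan)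
    then show ?thesis by (simp add: NTN trace_mat_def)
  qed
  have trace: "trace_mat (U * U\<^sup>T * M) = (\<Sum>i<d. es ! i * w i)"
  proof -
    have "trace_mat (U * U\<^sup>T * M) = trace_mat (U * (U\<^sup>T * M))"
      using U M by (simp add: assoc_mult_mat[of U d k "U\<^sup>T" d M d])
    also have "\<dots> = trace_mat (U\<^sup>T * M * U)"
      by (rule trace_mat_mult_commute[of _ d k]) (use U M in auto)
    also have "U\<^sup>T * M * U = U\<^sup>T * (M * (Q * N))"
      using assoc_mult_mat[OF _ M U, of "U\<^sup>T" k] U by (simp add: QN)
    also have "M * (Q * N) = (M * Q) * N"
      by (rule assoc_mult_mat[OF M Q N, symmetric])
    also have "\<dots> = Q * (mat_diag d ((!) es) * N)"
      unfolding MQ by (rule assoc_mult_mat[OF Q mat_diag_dim N])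
    also have "U\<^sup>T * \<dots> = N\<^sup>T * (mat_diag d ((!) es) * N)"
      unfolding NT by (rule assoc_mult_mat[symmetric, OF _ Q]) (use U mult_carrier_mat[OF mat_diag_dim N] in auto)
    also have "trace_mat \<dots> = (\<Sum>j<k. \<Sum>i<d. es ! i * (N $$ (i, j))\<^sup>2)"
      using N by (simp add: trace_mat_def mat_diag_mult_left scalar_prod_def atLeast0LessThan
          power2_eq_square mult.left_commute)
    also have "\<dots> = (\<Sum>i<d. es ! i * w i)"
      by (subst sum.swap) (simp add: w_def sum_distrib_left)
    finally show ?thesis .
  qed

  have "(frobenius_norm (V\<^sup>T * U))\<^sup>2 \<le> \<epsilon> * top_eigenvalue_sum k M / (\<Gamma> * b)"
    if V: "eigenspace_below_basis ((1 - \<Gamma>) * b) M V" for V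
  proof -
    define r where "r = dim_col V"
    have Vc: "V \<in> carrier_mat d r" and VTV: "V\<^sup>T * V = 1\<^sub>m r"
      using V M by (auto simp: eigenspace_below_basis_def orthonormal_mat_def r_def)
    \<comment> \<open>The coordinates of the columns of \<open>V\<close> in the eigenbasis.\<close>
    define Y where "Y = Q\<^sup>T * V"
    have Y: "Y \<in> carrier_mat d r" using Q Vc by (simp add: Y_def)
    have YT: "Y\<^sup>T = V\<^sup>T * Q" using Q Vc by (simp add: Y_def transpose_mult[of _ d d _ r])
    have QY: "Q * Y = V"
      using assoc_mult_mat[OF Q _ Vc, of "Q\<^sup>T"] Q Vc by (simp add: Y_def QQT)
    have YTY: "Y\<^sup>T * Y = 1\<^sub>m r"
      unfolding YT using assoc_mult_mat[OF _ Q Y, of "V\<^sup>T" r] Vc by (simp add: QY VTV)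
    have Y0: "Y $$ (i, j) = 0" if "i < d" "j < r" "(1 - \<Gamma>) * b \<le> es ! i" for i j
      using eigenspace_below_basis_orthogonal[OF M sym V _ q_eigen that(3), of j] that Q Vc
      by (simp add: Y_def)
    \<comment> \<open>As the rows of \<open>Y\<close> for eigenvalues at or above the threshold vanish, those of \<open>N\<close> can be cut off
      before Bessel's inequality is applied; without the cut the bound would only be \<open>k\<close>.\<close>
    define N' where "N' = mat d k (\<lambda>(i, j). if es ! i < (1 - \<Gamma>) * b then N $$ (i, j) else 0)"
    have N': "N' \<in> carrier_mat d k" by (simp add: N'_def)
    have "V\<^sup>T * U = Y\<^sup>T * N"
      unfolding YT using assoc_mult_mat[OF _ Q N, of "V\<^sup>T" r] Vc by (simp add: QN)
    also have "\<dots> = Y\<^sup>T * N'"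
    proof (rule eq_matI)
      fix i j assume "i < dim_row (Y\<^sup>T * N')" "j < dim_col (Y\<^sup>T * N')"
      then have "i < r" "j < k" using Y N' by auto
      then show "(Y\<^sup>T * N) $$ (i, j) = (Y\<^sup>T * N') $$ (i, j)"
        using Y N N' Y0 by (auto simp: scalar_prod_def N'_def intro!: sum.cong)
    qed (use N N' in auto)
    finally have "(frobenius_norm (V\<^sup>T * U))\<^sup>2 \<le> (frobenius_norm N')\<^sup>2"
      using frobenius_norm_sq_orthonormal_le[OF Y YTY N'] by simp
    also have "\<dots> = (\<Sum>i<d. if es ! i < b - \<Gamma> * b then w i else 0)"
      unfolding frobenius_norm_sq by (auto simp: N'_def w_def algebra_simps intro!: sum.cong)
    also have "\<dots> \<le> \<epsilon> * top_eigenvalue_sum k M / (\<Gamma> * b)"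
    proof -
      have "\<Gamma> * b * (\<Sum>i<d. if es ! i < b - \<Gamma> * b then w i else 0)
          \<le> (\<Sum>i<k. es ! i) - (\<Sum>i<d. es ! i * w i)"
        unfolding b_nth
        by (rule top_sum_minus_weighted_sum_ge[OF k es_anti w_nonneg w_le_1 sum_w])
          (use \<Gamma> b_pos in \<open>auto simp: b_nth\<close>)
      also have "\<dots> \<le> \<epsilon> * top_eigenvalue_sum k M"
        using trace_ge unfolding trace top_sum by (simp add: algebra_simps)
      finally show ?thesis
        using \<Gamma> b_pos by (simp add: pos_le_divide_eq mult.commute)
    qed
    finally show ?thesis .
  qed
  then show ?thesis
    using U U_orth M unfolding is_cPCA_def b_def by auto
qed

end
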